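(* Let $K_1,\dots,K_r\subset\mathbb{R}^n$ be nonempty closed convex sets with $K:=\bigcap_{l=1}^rK_l=\emptyset$ and $\bigcap_{l=1}^rR(K_l)=\{0\}$. Suppose either the SHQP algorithm with $\bar p=\infty$ or the BAP algorithm (both described in the context) is run, and that $$S_i\subset S_{i+1}\ \text{ for all } i\ge0,\qquad (i,l_i^* )\in S_i\ \text{ for all } i\ge0.$$ Then for any starting point $x_0$, the algorithm terminates with $\tilde F_i=\emptyset$ (for the SHQP algorithm) or $F_i=\emptyset$ (for the BAP algorithm) after finitely many iterations.
   Context: $R(S)=\{d: x+td\in S\ \forall t\ge0,\ \forall x\in S\}$ is the recession cone of a convex set $S$. $P_C$ is the Euclidean projection onto $C$; $\mathrm{conv}$ is the convex hull; $\mathrm{pos}(S)=\{ts\mid t\ge0,\ s\in S\}$. Common notation: at iteration $i$, for $l\in\{1,\dots,r\}$, $x_i^{(l)}=P_{K_l}(x_i)$, $a_i^{(l)}=x_i-x_i^{(l)}$, $b_i^{(l)}=\langle a_i^{(l)},x_i^{(l)}\rangle$; $l_i^*\in\{1,\dots,r\}$ is an index attaining $\max_{1\le l\le r}\|x_i-P_{K_l}(x_i)\|$; $H^{\le}_{(j,l)}=\{x:\langle a_j^{(l)},x\rangle\le b_j^{(l)}\}$. SHQP algorithm (with $\bar p=\infty$): starting from $x_0$, at iteration $i\ge 0$ choose $S_i\subset\{0,\dots,i\}\times\{1,\dots,r\}$, set $\tilde F_i=\bigcap_{(j,l)\in S_i}H^{\le}_{(j,l)}$, and choose $x_{i+1}$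 such that (1) $x_{i+1}\in\tilde F_i$; (2) $\|x_{i+1}-c\|\le\|x_i-c\|$ for all $c\in K$; (3) $x_i-x_{i+1}\in\mathrm{pos}(\mathrm{conv}\{a_j^{(l)}:(j,l)\in S_i\})$. It stops if $\tilde F_i=\emptyset$. BAP algorithm: starting from $x_0$, at iteration $i\ge 0$ choose $S_i\subset\{0,\dots,i\}\times\{1,\dots,r\}$, set $F_i=\bigcap_{(j,l)\in S_i}H^{\le}_{(j,l)}$, and let $x_{i+1}=P_{F_i}(x_0)$. It stops if $F_i=\emptyset$. *)

theory Defs
  imports "HOL-Analysis.Analysis"
begin

definition recession_cone :: "(real ^ 'n) set \<Rightarrow> (real ^ 'n) set" where
  "recession_cone C = {d. \<forall>t\<ge>0. \<forall>x\<in>C. x + t *\<^sub>R d \<in> C}"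

definition pos :: "(real ^ 'n) set \<Rightarrow> (real ^ 'n) set" where
  "pos A = {t *\<^sub>R s | t s. 0 \<le> t \<and> s \<in> A}"

lemma pos_eq_cone_hull: "pos A = cone hull A"
  by (simp add: pos_def cone_hull_expl)

text \<open>
  Throughout, the sets are \<open>K l\<close> for \<open>l \<in> {1..r}\<close>, the iterates are \<open>x i\<close>, and \<open>S i\<close> is the
  index set chosen at iteration \<open>i\<close>. A pair \<open>(j, l)\<close> stands for the iterate \<open>x j\<close> and the set \<open>K l\<close>.
\<close>

definition avec :: "(nat \<Rightarrow> (real ^ 'n) set) \<Rightarrow> (nat \<Rightarrow> real ^ 'n) \<Rightarrow> nat \<times> nat \<Rightarrow> real ^ 'n" where
  "avec K x = (\<lambda>(j, l). x j - closest_point (K l) (x j))"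

definition bval :: "(nat \<Rightarrow> (real ^ 'n) set) \<Rightarrow> (nat \<Rightarrow> real ^ 'n) \<Rightarrow> nat \<times> nat \<Rightarrow> real" where
  "bval K x = (\<lambda>(j, l). avec K x (j, l) \<bullet> closest_point (K l) (x j))"

definition halfsp :: "(nat \<Rightarrow> (real ^ 'n) set) \<Rightarrow> (nat \<Rightarrow> real ^ 'n) \<Rightarrow> nat \<times> nat \<Rightarrow> (real ^ 'n) set" where
  "halfsp K x p = {y. avec K x p \<bullet> y \<le> bval K x p}"

definition polyF ::
  "(nat \<Rightarrow> (real ^ 'n) set) \<Rightarrow> (nat \<Rightarrow> real ^ 'n) \<Rightarrow> (nat \<Rightarrow> (nat \<times> nat) set) \<Rightarrow> nat \<Rightarrow> (real ^ 'n) set"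
  where
  "polyF K x S i = (\<Inter>p\<in>S i. halfsp K x p)"

text \<open>
  Sequences are total functions, so a run that stops early is modelled by leaving all values after
  the stop unconstrained: iteration \<open>i\<close> takes place iff no earlier polyhedron is empty, and
  requirements on iteration \<open>i\<close> are imposed only in that case.
\<close>

definition reached ::
  "(nat \<Rightarrow> (real ^ 'n) set) \<Rightarrow> (nat \<Rightarrow> real ^ 'n) \<Rightarrow> (nat \<Rightarrow> (nat \<times> nat) set) \<Rightarrow> nat \<Rightarrow> bool" where
  "reached K x S i \<longleftrightarrow> (\<forall>j<i. polyF K x S j \<noteq> {})"

definition SHQP_run ::
  "nat \<Rightarrow> (nat \<Rightarrow> (real ^ 'n) set) \<Rightarrow> real ^ 'n \<Rightarrow> (nat \<Rightarrow> real ^ 'n) \<Rightarrow> (nat \<Rightarrow> (nat \<times> nat) set) \<Rightarrow> bool"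
  where
  "SHQP_run r K x0 x S \<longleftrightarrow>
     x 0 = x0 \<and>
     (\<forall>i. reached K x S i \<longrightarrow>
        S i \<subseteq> {0..i} \<times> {1..r} \<and>
        (polyF K x S i \<noteq> {} \<longrightarrow>
           x (Suc i) \<in> polyF K x S i \<and>
           (\<forall>c\<in>(\<Inter>l\<in>{1..r}. K l). norm (x (Suc i) - c) \<le> norm (x i - c)) \<and>
           x i - x (Suc i) \<in> pos (convex hull (avec K x ` S i))))"

definition BAP_run ::
  "nat \<Rightarrow> (nat \<Rightarrow> (real ^ 'n) set) \<Rightarrow> real ^ 'n \<Rightarrow> (nat \<Rightarrow> real ^ 'n) \<Rightarrow> (nat \<Rightarrow> (nat \<times> nat) set) \<Rightarrow> bool"
  where
  "BAP_run r K x0 x S \<longleftrightarrow>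
     x 0 = x0 \<and>
     (\<forall>i. reached K x S i \<longrightarrow>
        S i \<subseteq> {0..i} \<times> {1..r} \<and>
        (polyF K x S i \<noteq> {} \<longrightarrow> x (Suc i) = closest_point (polyF K x S i) x0))"

end

theory Submission
  imports Defs
begin

text \<open>
  Suppose that the algorithm never stops. Write \<open>a\<^sub>k = x\<^sub>k - p\<^sub>k\<close>, where \<open>p\<^sub>k\<close> is the projection of
  \<open>x\<^sub>k\<close> onto a farthest set. As the polyhedra decrease, every later iterate satisfies the cut made
  at time \<open>k\<close>: \<open>\<langle>a\<^sub>k, x\<^sub>m - p\<^sub>k\<rangle> \<le> 0\<close> for all \<open>m > k\<close>. This single property, common to both
  algorithms, cannot hold when the \<open>K\<^sub>l\<close> have neither a common point nor a common nonzero direction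
  of recession.

  If the iterates are bounded, some subsequence converges. The cut forces
  \<open>\<parallel>x\<^sub>m - x\<^sub>k\<parallel> \<ge> \<parallel>a\<^sub>k\<parallel>\<close>, so the largest distance to the sets tends to \<open>0\<close> along it and the limit
  lies in every \<open>K\<^sub>l\<close> (\<open>bounded_cut_sequence_meets_all\<close>).

  If they are unbounded, some subsequence has norms tending to infinity and normalised iterates
  tending to a unit vector \<open>d\<close>. Dividing the cut by \<open>\<parallel>x\<^sub>m\<parallel>\<close> and letting \<open>m\<close> grow gives
  \<open>\<langle>a\<^sub>k, d\<rangle> \<le> 0\<close>. On the other hand \<open>a\<^sub>k\<close> is an outer normal of the farthest set at \<open>p\<^sub>k\<close>, so
  \<open>\<parallel>a\<^sub>k\<parallel>\<^sup>2\<close> is at most \<open>\<langle>a\<^sub>k, x\<^sub>k\<rangle>\<close> plus a multiple of \<open>\<parallel>a\<^sub>k\<parallel>\<close>. As \<open>x\<^sub>k\<close> is close to \<open>\<parallel>x\<^sub>k\<parallel> d\<close>, the two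
  facts give \<open>\<parallel>a\<^sub>k\<parallel> = o(\<parallel>x\<^sub>k\<parallel>)\<close>: the projections of the iterates onto each set go to infinity in
  the same direction \<open>d\<close>, which is therefore a common direction of recession
  (\<open>unbounded_cut_sequence_common_recession\<close>).
\<close>

text \<open>
  A point \<open>y + t d\<close> is the limit of the points of the segments from \<open>y\<close> to \<open>p k\<close> that lie at the
  fraction \<open>t / s k\<close>.
\<close>

lemma asymptotic_direction_in_recession_cone:
  fixes C :: "(real ^ 'n) set"
  assumes "closed C" "convex C"
    and p: "\<And>k. p k \<in> C"
    and s: "filterlim s at_top sequentially"
    and lim: "(\<lambda>k. p k /\<^sub>R s k) \<longlonglongrightarrow> d"
  shows "d \<in> recession_cone C"
proof -
  have "y + t *\<^sub>R d \<in> C" if t: "t \<ge> 0" and y: "y \<in> C" for t y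
  proof -
    let ?q = "\<lambda>k. (1 - t / s k) *\<^sub>R y + (t / s k) *\<^sub>R p k"
    have frac: "(\<lambda>k. t / s k) \<longlonglongrightarrow> 0"
      by (rule real_tendsto_divide_at_top[OF tendsto_const s])
    have "(\<lambda>k. (1 - t / s k) *\<^sub>R y + t *\<^sub>R (p k /\<^sub>R s k)) \<longlonglongrightarrow> (1 - 0) *\<^sub>R y + t *\<^sub>R d"
      by (intro tendsto_intros frac lim)
    then have q: "?q \<longlonglongrightarrow> y + t *\<^sub>R d"
      by (simp add: divide_inverse)
    have "eventually (\<lambda>k. s k \<ge> max 1 t) sequentially"
      using s unfolding filterlim_at_top by blast
    then have "eventually (\<lambda>k. ?q k \<in> C) sequentially"
    proof eventually_elim
      case (elim k)
      then show ?case
        using t y p[of k] \<open>convex C\<close> by (intro convexD) (auto simp: field_simps)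
    qed
    from Lim_in_closed_set[OF \<open>closed C\<close> this trivial_limit_sequentially q] show ?thesis .
  qed
  then show ?thesis
    by (simp add: recession_cone_def)
qed

lemma unbounded_sequence_escaping_subsequence:
  fixes x :: "nat \<Rightarrow> 'a::euclidean_space"
  assumes "\<not> bounded (range x)"
  obtains \<sigma> d where "strict_mono (\<sigma> :: nat \<Rightarrow> nat)"
    "filterlim (\<lambda>k. norm (x (\<sigma> k))) at_top sequentially"
    "(\<lambda>k. x (\<sigma> k) /\<^sub>R norm (x (\<sigma> k))) \<longlonglongrightarrow> d" "norm d = 1"
proof -
  have large: "\<exists>m>n. norm (x m) \<ge> B" for n and B :: real
  proof (rule ccontr)
    assume "\<not> ?thesis"
    then have "x ` {n<..} \<subseteq> cball 0 B"
      by (force simp: not_le)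
    then have "bounded (x ` {..n} \<union> x ` {n<..})"
      by (meson bounded_Un bounded_cball bounded_subset finite_atMost finite_imageI finite_imp_bounded)
    moreover have "{..n} \<union> {n<..} = UNIV" by auto
    ultimately show False
      using assms by (metis image_Un)
  qed
  obtain \<tau> where \<tau>: "\<And>n. norm (x (\<tau> n)) \<ge> real (Suc n)" "\<And>n. \<tau> n < \<tau> (Suc n)"
  proof -
    have "\<exists>\<tau>. \<forall>n. norm (x (\<tau> n)) \<ge> real (Suc n) \<and> \<tau> n < \<tau> (Suc n)"
      by (rule dependent_nat_choice) (use large in blast)+
    then show ?thesis using that by blast
  qed
  define u where "u = (\<lambda>n. x (\<tau> n) /\<^sub>R norm (x (\<tau> n)))"
  have "norm (u n) = 1" for n
  proof -
    have "norm (x (\<tau> n)) \<noteq> 0"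
      using \<tau>(1)[of n] by linarith
    then show ?thesis
      by (simp add: u_def)
  qed
  then have "\<And>n. u n \<in> sphere 0 1"
    by simp
  then obtain d \<rho> where d: "d \<in> sphere 0 1" "strict_mono (\<rho> :: nat \<Rightarrow> nat)" "(u \<circ> \<rho>) \<longlonglongrightarrow> d"
    using compact_sphere compact_def by metis
  have "strict_mono \<tau>"
    by (simp add: \<tau>(2) strict_mono_Suc_iff)
  then have mono: "strict_mono (\<tau> \<circ> \<rho>)"
    using d(2) by (rule strict_mono_o)
  have "real k \<le> norm (x ((\<tau> \<circ> \<rho>) k))" for k
    using \<tau>(1)[of "\<rho> k"] seq_suble[OF d(2), of k] by simp
  then have "filterlim (\<lambda>k. norm (x ((\<tau> \<circ> \<rho>) k))) at_top sequentially"
    by (intro filterlim_at_top_mono[OF filterlim_real_sequentially]) auto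
  then show ?thesis
    using that[OF mono] d by (simp add: u_def o_def)
qed

text \<open>
  The cut made at \<open>x k\<close> removes the whole open ball around \<open>x k\<close> that reaches the farthest set, so
  in a convergent subsequence the distances to the farthest sets are squeezed to \<open>0\<close> by the gaps
  between consecutive terms.
\<close>

lemma bounded_cut_sequence_meets_all:
  fixes K :: "'i \<Rightarrow> 'a::euclidean_space set" and x :: "nat \<Rightarrow> 'a"
  assumes K: "\<And>l. l \<in> I \<Longrightarrow> K l \<noteq> {} \<and> closed (K l)"
    and far: "\<And>k l. l \<in> I \<Longrightarrow> norm (x k - closest_point (K l) (x k)) \<le> norm (x k - p k)"
    and cut: "\<And>k m. k < m \<Longrightarrow> (x k - p k) \<bullet> (x m - p k) \<le> 0"
    and bd: "bounded (range x)"
  shows "(\<Inter>l\<in>I. K l) \<noteq> {}"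
proof -
  obtain c \<sigma> where \<sigma>: "strict_mono (\<sigma> :: nat \<Rightarrow> nat)" and c: "(x \<circ> \<sigma>) \<longlonglongrightarrow> c"
    using bd bounded_imp_convergent_subsequence by blast
  have gap: "norm (x k - p k) \<le> norm (x k - x m)" if "k < m" for k m
  proof -
    have "(x k - p k) \<bullet> (x k - p k) \<le> (x k - p k) \<bullet> (x k - x m)"
      using cut[OF that] by (simp add: inner_diff_right)
    also have "\<dots> \<le> norm (x k - p k) * norm (x k - x m)"
      by (rule norm_cauchy_schwarz)
    finally have "norm (x k - p k) * norm (x k - p k) \<le> norm (x k - p k) * norm (x k - x m)"
      by (simp add: dot_square_norm power2_eq_square)
    then show ?thesis
      by (cases "norm (x k - p k) = 0") auto
  qed
  have "c \<in> K l" if l: "l \<in> I" for l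
  proof -
    let ?q = "\<lambda>k. closest_point (K l) (x (\<sigma> k))"
    have "(\<lambda>k. norm (x (\<sigma> k) - x (\<sigma> (Suc k)))) \<longlonglongrightarrow> norm (c - c)"
      using c LIMSEQ_Suc[OF c] by (intro tendsto_norm tendsto_diff) (auto simp: o_def)
    then have gap0: "(\<lambda>k. norm (x (\<sigma> k) - x (\<sigma> (Suc k)))) \<longlonglongrightarrow> 0"
      by simp
    have "norm (x (\<sigma> k) - ?q k) \<le> norm (x (\<sigma> k) - x (\<sigma> (Suc k)))" for k
      using far[OF l, of "\<sigma> k"] gap[of "\<sigma> k" "\<sigma> (Suc k)"] \<sigma>
      by (force simp: strict_mono_def)
    then have "(\<lambda>k. x (\<sigma> k) - ?q k) \<longlonglongrightarrow> 0"
      by (intro Lim_null_comparison[OF always_eventually gap0]) blast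
    from tendsto_diff[OF c this] have "?q \<longlonglongrightarrow> c"
      by (simp add: o_def)
    then show ?thesis
      using closed_sequentially[of "K l" ?q c] K[OF l] closest_point_in_set by blast
  qed
  then show ?thesis by blast
qed

text \<open>
  An unbounded sequence has to escape along some direction \<open>d\<close>. The cuts bound how far \<open>d\<close> may point
  away from the sets, \<open>\<langle>a\<^sub>k, d\<rangle> \<le> 0\<close>, while the distance of \<open>x\<^sub>k\<close> to the farthest set could grow
  linearly in \<open>\<parallel>x\<^sub>k\<parallel>\<close> only if \<open>\<langle>a\<^sub>k, d\<rangle>\<close> were positive for some large \<open>k\<close>. Hence,
  along the escaping subsequence, every set stays within \<open>o(\<parallel>x\<^sub>k\<parallel>)\<close> of \<open>x\<^sub>k\<close> and contains points
  going to infinity in direction \<open>d\<close>.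
\<close>

lemma unbounded_cut_sequence_common_recession:
  fixes K :: "'i \<Rightarrow> (real ^ 'n) set" and x :: "nat \<Rightarrow> real ^ 'n"
  assumes fin: "finite I"
    and K: "\<And>l. l \<in> I \<Longrightarrow> K l \<noteq> {} \<and> closed (K l) \<and> convex (K l)"
    and L: "\<And>k. L k \<in> I"
    and p: "\<And>k. p k = closest_point (K (L k)) (x k)"
    and far: "\<And>k l. l \<in> I \<Longrightarrow> norm (x k - closest_point (K l) (x k)) \<le> norm (x k - p k)"
    and cut: "\<And>k m. k < m \<Longrightarrow> (x k - p k) \<bullet> (x m - p k) \<le> 0"
    and unbd: "\<not> bounded (range x)"
  obtains d where "norm d = 1" "d \<in> (\<Inter>l\<in>I. recession_cone (K l))"
proof -
  obtain \<sigma> d where \<sigma>: "strict_mono (\<sigma> :: nat \<Rightarrow> nat)"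
    and inf: "filterlim (\<lambda>k. norm (x (\<sigma> k))) at_top sequentially"
    and dir: "(\<lambda>k. x (\<sigma> k) /\<^sub>R norm (x (\<sigma> k))) \<longlonglongrightarrow> d" and d: "norm d = 1"
    using unbounded_sequence_escaping_subsequence[OF unbd] by blast
  let ?a = "\<lambda>k. x k - p k"
  have "\<forall>l\<in>I. \<exists>z. z \<in> K l" using K by auto
  then obtain z where z: "\<And>l. l \<in> I \<Longrightarrow> z l \<in> K l" by metis
  define M where "M = (\<Sum>l\<in>I. norm (z l))"
  have M: "norm (z l) \<le> M" if "l \<in> I" for l
    unfolding M_def using fin that by (intro member_le_sum) auto
  \<comment> \<open>The cut made at \<open>x k\<close> is tested on ever larger later iterates, with \<open>k\<close> fixed.\<close>
  have ad: "?a k \<bullet> d \<le> 0" for k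
  proof -
    have "(\<lambda>m. ?a k \<bullet> (x (\<sigma> m) /\<^sub>R norm (x (\<sigma> m))) - ?a k \<bullet> p k / norm (x (\<sigma> m)))
            \<longlonglongrightarrow> ?a k \<bullet> d - 0"
      by (intro tendsto_diff tendsto_inner tendsto_const dir real_tendsto_divide_at_top[OF tendsto_const inf])
    moreover have "?a k \<bullet> (x (\<sigma> m) /\<^sub>R norm (x (\<sigma> m))) - ?a k \<bullet> p k / norm (x (\<sigma> m)) \<le> 0"
      if "m \<ge> Suc k" for m
    proof -
      have "k < \<sigma> m"
        using that seq_suble[OF \<sigma>, of m] by simp
      then have "?a k \<bullet> (x (\<sigma> m) - p k) / norm (x (\<sigma> m)) \<le> 0"
        using cut by (simp add: divide_nonpos_nonneg)
      moreover have "?a k \<bullet> (x (\<sigma> m) /\<^sub>R norm (x (\<sigma> m))) - ?a k \<bullet> p k / norm (x (\<sigma> m))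
          = ?a k \<bullet> (x (\<sigma> m) - p k) / norm (x (\<sigma> m))"
        unfolding inner_diff_right[of _ "x (\<sigma> m)" "p k"] inner_scaleR_right
        by (simp add: divide_inverse algebra_simps)
      ultimately show ?thesis by linarith
    qed
    ultimately have "?a k \<bullet> d - 0 \<le> 0"
      by (blast intro: LIMSEQ_le_const2)
    then show ?thesis by simp
  qed
  \<comment> \<open>The normal inequality at \<open>p k\<close> is tested on a base point that depends only on the set, so
    that the additive error \<open>M\<close> does not depend on \<open>k\<close>.\<close>
  have bound: "norm (?a k) \<le> norm (x k - norm (x k) *\<^sub>R d) + M" for k
  proof -
    have "?a k \<bullet> (z (L k) - p k) \<le> 0"
      using closest_point_dot[of "K (L k)" "z (L k)" "x k"] K[OF L] z[OF L] by (simp add: p)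
    then have "?a k \<bullet> ?a k \<le> ?a k \<bullet> (x k - z (L k))"
      by (simp add: inner_diff_right)
    also have "\<dots> = ?a k \<bullet> ((x k - norm (x k) *\<^sub>R d) - z (L k)) + norm (x k) * (?a k \<bullet> d)"
      by (simp add: inner_diff_right)
    also have "\<dots> \<le> ?a k \<bullet> ((x k - norm (x k) *\<^sub>R d) - z (L k))"
      using ad[of k] by (simp add: mult_nonneg_nonpos)
    also have "\<dots> \<le> norm (?a k) * norm ((x k - norm (x k) *\<^sub>R d) - z (L k))"
      by (rule norm_cauchy_schwarz)
    finally have "norm (?a k) * norm (?a k) \<le> norm (?a k) * norm ((x k - norm (x k) *\<^sub>R d) - z (L k))"
      by (simp add: dot_square_norm power2_eq_square)
    then have "norm (?a k) \<le> norm ((x k - norm (x k) *\<^sub>R d) - z (L k))"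
      by (cases "norm (?a k) = 0") auto
    also have "\<dots> \<le> norm (x k - norm (x k) *\<^sub>R d) + M"
      using norm_triangle_ineq4[of "x k - norm (x k) *\<^sub>R d" "z (L k)"] M[OF L, of k] by simp
    finally show ?thesis .
  qed
  have "d \<in> recession_cone (K l)" if l: "l \<in> I" for l
  proof -
    let ?s = "\<lambda>k. norm (x (\<sigma> k))"
    let ?u = "\<lambda>k. x (\<sigma> k) /\<^sub>R ?s k"
    let ?q = "\<lambda>k. closest_point (K l) (x (\<sigma> k))"
    have "(\<lambda>k. norm (?u k - d) + M / ?s k) \<longlonglongrightarrow> norm (d - d) + 0"
      by (intro tendsto_intros dir real_tendsto_divide_at_top[OF tendsto_const inf])
    then have small: "(\<lambda>k. norm (?u k - d) + M / ?s k) \<longlonglongrightarrow> 0"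
      by simp
    have "eventually (\<lambda>k. ?s k \<ge> 1) sequentially"
      using inf by (simp add: filterlim_at_top)
    then have "eventually (\<lambda>k. norm ((x (\<sigma> k) - ?q k) /\<^sub>R ?s k) \<le> norm (?u k - d) + M / ?s k) sequentially"
    proof eventually_elim
      case (elim k)
      then have s: "?s k > 0" by linarith
      have "norm (x (\<sigma> k) - ?q k) / ?s k \<le> (norm (x (\<sigma> k) - ?s k *\<^sub>R d) + M) / ?s k"
        using far[OF l, of "\<sigma> k"] bound[of "\<sigma> k"] by (intro divide_right_mono) auto
      also have "x (\<sigma> k) - ?s k *\<^sub>R d = ?s k *\<^sub>R (?u k - d)"
        using s by (simp add: scaleR_diff_right)
      also have "(norm (?s k *\<^sub>R (?u k - d)) + M) / ?s k = norm (?u k - d) + M / ?s k"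
        using s unfolding norm_scaleR by (simp add: add_divide_distrib)
      finally show ?case
        by (simp add: divide_inverse mult.commute)
    qed
    from Lim_null_comparison[OF this small]
    have "(\<lambda>k. (x (\<sigma> k) - ?q k) /\<^sub>R ?s k) \<longlonglongrightarrow> 0" .
    from tendsto_diff[OF dir this] have "(\<lambda>k. ?q k /\<^sub>R ?s k) \<longlonglongrightarrow> d"
      by (simp add: scaleR_diff_right)
    then show ?thesis
      using K[OF l] by (intro asymptotic_direction_in_recession_cone[OF _ _ _ inf]) (auto intro: closest_point_in_set)
  qed
  then show ?thesis using that d by blast
qed

lemma closed_polyF: "closed (polyF K x S i)"
  unfolding polyF_def halfsp_def by (auto intro!: closed_INT closed_halfspace_le)

theorem corollary5p4:
  fixes K :: "nat \<Rightarrow> (real ^ 'n) set"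
    and r :: nat
    and x0 :: "real ^ 'n"
    and x :: "nat \<Rightarrow> real ^ 'n"
    and S :: "nat \<Rightarrow> (nat \<times> nat) set"
    and lstar :: "nat \<Rightarrow> nat"
  assumes "\<And>l. l \<in> {1..r} \<Longrightarrow> K l \<noteq> {} \<and> closed (K l) \<and> convex (K l)"
    and "(\<Inter>l\<in>{1..r}. K l) = {}"
    and "(\<Inter>l\<in>{1..r}. recession_cone (K l)) = {0}"
    and "SHQP_run r K x0 x S \<or> BAP_run r K x0 x S"
    and "\<And>i. reached K x S (Suc i) \<Longrightarrow> S i \<subseteq> S (Suc i)"
    and "\<And>i. reached K x S i \<Longrightarrow>
           is_arg_max (\<lambda>l. norm (x i - closest_point (K l) (x i))) (\<lambda>l. l \<in> {1..r}) (lstar i)"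
    and "\<And>i. reached K x S i \<Longrightarrow> (i, lstar i) \<in> S i"
  shows "\<exists>N. reached K x S N \<and> polyF K x S N = {}"
proof (rule ccontr)
  assume never: "\<not> ?thesis"
  have reached: "reached K x S i" for i
    by (induction i) (use never in \<open>auto simp: reached_def less_Suc_eq\<close>)
  then have nonempty: "polyF K x S i \<noteq> {}" for i
    using never by blast
  have step: "x (Suc i) \<in> polyF K x S i" for i
    using assms(4) reached[of i] nonempty[of i] closest_point_in_set[OF closed_polyF nonempty]
    by (auto simp: SHQP_run_def BAP_run_def)
  have lstar: "lstar k \<in> {1..r}"
    and far: "\<And>l. l \<in> {1..r} \<Longrightarrow> norm (x k - closest_point (K l) (x k))
                \<le> norm (x k - closest_point (K (lstar k)) (x k))" for k
    using assms(6)[OF reached[of k]] by (auto simp: is_arg_max_linorder)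
  have cut: "(x k - closest_point (K (lstar k)) (x k)) \<bullet> (x m - closest_point (K (lstar k)) (x k)) \<le> 0"
    if "k < m" for k m
  proof -
    obtain i where m: "m = Suc i" and "k \<le> i"
      using \<open>k < m\<close> by (cases m) auto
    have "S k \<subseteq> S i"
      using assms(5)[OF reached] \<open>k \<le> i\<close> by (rule lift_Suc_mono_le)
    then have "(k, lstar k) \<in> S i"
      using assms(7)[OF reached[of k]] by blast
    then have "x m \<in> halfsp K x (k, lstar k)"
      using step[of i] by (auto simp: m polyF_def)
    then show ?thesis
      by (simp add: halfsp_def bval_def avec_def inner_diff_right)
  qed
  let ?p = "\<lambda>k. closest_point (K (lstar k)) (x k)"
  show False
  proof (cases "bounded (range x)")
    case True
    have "K l \<noteq> {} \<and> closed (K l)" if "l \<in> {1..r}" for l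
      using assms(1)[OF that] by simp
    from bounded_cut_sequence_meets_all[where K=K and I="{1..r}" and x=x and p="?p", OF this far cut True]
    have "(\<Inter>l\<in>{1..r}. K l) \<noteq> {}" .
    then show False
      using assms(2) by contradiction
  next
    case False
    obtain d where "norm d = 1" "d \<in> (\<Inter>l\<in>{1..r}. recession_cone (K l))"
      by (rule unbounded_cut_sequence_common_recession[where K=K and I="{1..r}" and x=x and L=lstar
            and p="?p", OF finite_atLeastAtMost assms(1) lstar refl far cut False])
    then show False
      unfolding assms(3) by simp
  qed
qed

end
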